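(* Let $\mathcal{F}_S$ denote the class of graphs containing a spanning star, that is, a vertex connected to all other vertices in the graph. If $n$ is even, then $$D_{\mathcal{F}_S}(n)=2^{\binom{n}{2}-\frac{n}{2}}.$$ When $n$ is odd, then $$2^{\binom{n}{2}-\frac{n+1}{2}}\le D_{\mathcal{F}_S}(n)\le 2^{\binom{n}{2}-\frac{n}{2}}.$$
   Context: All graphs are finite and simple. For two graphs $G,G'$ on the vertex set $[n]=\{1,\dots,n\}$, $G\oplus G'$ denotes the graph on $[n]$ whose edge set is the symmetric difference of $E(G)$ and $E(G')$. For a class $\mathcal{F}$ of graphs, $D_{\mathcal{F}}(n)$ denotes the maximum possible size of a family of (labeled) graphs on vertex set $[n]$ such that $G\oplus G'\notin\mathcal{F}$ for any two distinct members $G,G'$ of the family.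
   Formalization: The odd case is stated for n > 1 only: for n = 1 there is exactly one graph, so D = 1, which exceeds the claimed upper bound 2^(-1/2). *)

theory Defs
  imports Complex_Main
begin

type_synonym graph = "nat set \<times> nat set set"

abbreviation verts :: "graph \<Rightarrow> nat set" where "verts \<equiv> fst"
abbreviation edges :: "graph \<Rightarrow> nat set set" where "edges \<equiv> snd"

definition simple_graph :: "graph \<Rightarrow> bool" where
  "simple_graph G \<longleftrightarrow>
     finite (verts G) \<and> (\<forall>e\<in>edges G. e \<subseteq> verts G \<and> card e = 2)"

definition graphs_on :: "nat \<Rightarrow> graph set" where
  "graphs_on n = {G. simple_graph G \<and> verts G = {1..n}}"

text \<open>Only meaningful when both graphs have the same vertex set.\<close>

definition graph_xor :: "graph \<Rightarrow> graph \<Rightarrow> graph" where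
  "graph_xor G G' = (verts G, sym_diff (edges G) (edges G'))"

definition diff_avoiding :: "graph set \<Rightarrow> nat \<Rightarrow> graph set \<Rightarrow> bool" where
  "diff_avoiding \<F> n A \<longleftrightarrow>
     A \<subseteq> graphs_on n \<and> (\<forall>G\<in>A. \<forall>G'\<in>A. G \<noteq> G' \<longrightarrow> graph_xor G G' \<notin> \<F>)"

text \<open>The maximum is over a finite nonempty set; see \<open>D_attained\<close> and \<open>D_upper\<close> below.\<close>

definition D :: "graph set \<Rightarrow> nat \<Rightarrow> nat" where
  "D \<F> n = Max {card A | A. diff_avoiding \<F> n A}"

definition spanning_star_graphs :: "graph set" where
  "spanning_star_graphs =
     {G. simple_graph G \<and> (\<exists>v\<in>verts G. \<forall>u\<in>verts G - {v}. {v, u} \<in> edges G)}"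

lemma finite_graphs_on: "finite (graphs_on n)"
proof (rule finite_subset)
  show "graphs_on n \<subseteq> {{1..n}} \<times> Pow (Pow {1..n})"
    unfolding graphs_on_def simple_graph_def by force
qed simp

lemma graph_xor_in_graphs_on:
  assumes "G \<in> graphs_on n" "G' \<in> graphs_on n"
  shows "graph_xor G G' \<in> graphs_on n"
  using assms unfolding graphs_on_def simple_graph_def graph_xor_def by simp blast

lemma finite_diff_avoiding_cards: "finite {card A | A. diff_avoiding \<F> n A}"
proof (rule finite_subset)
  show "{card A | A. diff_avoiding \<F> n A} \<subseteq> card ` Pow (graphs_on n)"
    by (auto simp: diff_avoiding_def)
qed (simp add: finite_graphs_on)

lemma D_attained: "\<exists>A. diff_avoiding \<F> n A \<and> card A = D \<F> n"
proof -
  have "diff_avoiding \<F> n {}"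
    by (simp add: diff_avoiding_def)
  then have "{card A | A. diff_avoiding \<F> n A} \<noteq> {}"
    by blast
  from Max_in[OF finite_diff_avoiding_cards this] show ?thesis
    unfolding D_def by force
qed

lemma D_upper: "diff_avoiding \<F> n A \<Longrightarrow> card A \<le> D \<F> n"
  unfolding D_def by (rule Max_ge[OF finite_diff_avoiding_cards]) blast

end

theory Submission
  imports Defs
begin

text \<open>
  Everything rests on one reformulation: \<open>G \<oplus> G'\<close> contains the spanning star at \<open>v\<close> exactly
  when \<open>G\<close> and \<open>G'\<close> are complementary on the set of the \<open>n - 1\<close> edges at \<open>v\<close>.

  For the upper bound, restrict all members of an admissible family to the edges at \<open>v\<close>. No two of
  these restrictions are complementary, so there are at most \<open>2 ^ (n - 2)\<close> of them. Every edge lies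
  in exactly two of the \<open>n\<close> stars. For such a double cover, Shearer's inequality
  (\<open>shearer_double_cover\<close>) bounds the square of the size of a family by the product of the numbers
  of its restrictions, here by \<open>2 ^ (n * (n - 2))\<close>. The square root of this is
  \<open>2\<close> to the power \<open>(n choose 2) - n / 2\<close>.

  For the lower bound, fix an edge cover with \<open>(n + 1) div 2\<close> edges: a perfect matching, with one
  more edge if \<open>n\<close> is odd. The graphs without edges from the cover are closed under symmetric
  difference, and none of them contains a spanning star, because each star contains an edge of the
  cover. For even \<open>n\<close> the two bounds agree.
\<close>

section \<open>Shearer's inequality for double covers\<close>

abbreviation traces :: "'a set set \<Rightarrow> 'a set \<Rightarrow> 'a set set" where
  "traces A S \<equiv> (\<lambda>a. a \<inter> S) ` A"

text \<open>
  The Cauchy--Schwarz inequality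
  \<open>sqrt (a * b) + sqrt (c * d) \<le> sqrt ((a + c) * (b + d))\<close>, stated for squares: it adds up the
  bounds for the two halves of a family in the induction step of Shearer's inequality.
\<close>

lemma cauchy_schwarz_sum_of_two:
  fixes x y a b c d C :: real
  assumes nonneg: "0 \<le> x" "0 \<le> y" "0 \<le> a" "0 \<le> b" "0 \<le> c" "0 \<le> d" "0 \<le> C"
    and x: "x\<^sup>2 \<le> a * b * C" and y: "y\<^sup>2 \<le> c * d * C"
  shows "(x + y)\<^sup>2 \<le> (a + c) * (b + d) * C"
proof -
  have "(2 * (x * y))\<^sup>2 = 4 * (x\<^sup>2 * y\<^sup>2)"
    by (simp add: power_mult_distrib)
  also have "\<dots> \<le> 4 * ((a * b * C) * (c * d * C))"
    using mult_mono[OF x y] nonneg by simp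
  also have "\<dots> = 4 * ((a * d) * (b * c)) * C\<^sup>2"
    by (simp add: power2_eq_square algebra_simps)
  also have "\<dots> \<le> (a * d + b * c)\<^sup>2 * C\<^sup>2"
  proof (rule mult_right_mono)
    show "4 * ((a * d) * (b * c)) \<le> (a * d + b * c)\<^sup>2"
      using zero_le_power2[of "a * d - b * c"] by (simp add: power2_eq_square algebra_simps)
  qed simp
  finally have "(2 * (x * y))\<^sup>2 \<le> ((a * d + b * c) * C)\<^sup>2"
    by (simp add: power_mult_distrib)
  then have "2 * (x * y) \<le> (a * d + b * c) * C"
    by (rule power2_le_imp_le) (use nonneg in simp)
  \<comment> \<open>The mixed terms of \<open>(a + c) * (b + d)\<close> absorb the mixed term of \<open>(x + y)\<^sup>2\<close>.\<close>
  with x y show ?thesis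
    by (simp add: power2_eq_square algebra_simps)
qed

text \<open>
  Induction on the ground set. A new element \<open>e\<close> splits the family into the sets without \<open>e\<close> and
  those with \<open>e\<close>. For the two parts \<open>S u\<close> and \<open>S w\<close> that contain \<open>e\<close>, the traces split
  accordingly, so their numbers add up; for the other parts the number of traces can only drop when
  passing to one half. The two instances of the induction hypothesis then combine by the
  Cauchy--Schwarz inequality.
\<close>

lemma shearer_double_cover:
  fixes A :: "'a set set" and S :: "'b \<Rightarrow> 'a set"
  assumes "finite E" "finite V" "A \<subseteq> Pow E"
    and "\<And>e. e \<in> E \<Longrightarrow> card {v \<in> V. e \<in> S v} = 2"
  shows "(card A)\<^sup>2 \<le> (\<Prod>v\<in>V. card (traces A (S v)))"
  using assms(1,3,4)
proof (induction E arbitrary: A rule: finite_induct)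
  case empty
  then have "A = {} \<or> A = {{}}" by auto
  then show ?case by auto
next
  case (insert e E)
  define A0 where "A0 = {a \<in> A. e \<notin> a}"
  define A1 where "A1 = (\<lambda>a. a - {e}) ` {a \<in> A. e \<in> a}"
  have "finite A"
    using insert.prems(1) insert.hyps(1) by (simp add: finite_subset)
  have sub0: "A0 \<subseteq> Pow E" and sub1: "A1 \<subseteq> Pow E"
    using insert.prems(1) by (auto simp: A0_def A1_def)
  have e_A1: "e \<notin> a" if "a \<in> A1" for a
    using that by (auto simp: A1_def)
  have inj: "inj_on (insert e) X" if "\<And>a. a \<in> X \<Longrightarrow> e \<notin> a" for X
    using that by (metis inj_onI insert_ident)
  have split: "A = A0 \<union> insert e ` A1"
    by (auto simp: A0_def A1_def image_image insert_absorb image_iff)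
  have fin: "finite A0" "finite A1"
    using \<open>finite A\<close> by (auto simp: A0_def A1_def)
  have cardA: "card A = card A0 + card A1"
  proof -
    have "card A = card A0 + card (insert e ` A1)"
      unfolding split using fin by (intro card_Un_disjoint) (auto simp: A0_def)
    then show ?thesis
      using card_image[OF inj[of A1]] e_A1 by simp
  qed
  have add: "card (traces A (S v)) = card (traces A0 (S v)) + card (traces A1 (S v))"
    if "e \<in> S v" for v
  proof -
    have "traces A (S v) = traces A0 (S v) \<union> insert e ` traces A1 (S v)"
      using that by (subst split) (auto simp: image_Un image_image)
    moreover have "traces A0 (S v) \<inter> insert e ` traces A1 (S v) = {}"
      by (auto simp: A0_def)
    moreover have "card (insert e ` traces A1 (S v)) = card (traces A1 (S v))"
      using e_A1 by (intro card_image inj) auto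
    ultimately show ?thesis
      using fin by (simp add: card_Un_disjoint)
  qed
  have mono0: "card (traces A0 (S v)) \<le> card (traces A (S v))" for v
    using \<open>finite A\<close> by (intro card_mono) (auto simp: A0_def)
  have mono1: "card (traces A1 (S v)) \<le> card (traces A (S v))" if "e \<notin> S v" for v
    using \<open>finite A\<close> that by (intro card_mono) (auto simp: A1_def image_iff)
  obtain u w where uw: "{v \<in> V. e \<in> S v} = {u, w}" "u \<noteq> w"
    using insert.prems(2)[of e] by (auto simp: card_2_iff)
  define V' where "V' = V - {u, w}"
  have V: "V = insert u (insert w V')" "u \<notin> insert w V'" "w \<notin> V'" "finite V'"
    using uw \<open>finite V\<close> by (auto simp: V'_def)
  have e_V': "e \<notin> S v" if "v \<in> V'" for v
    using that uw by (auto simp: V'_def)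
  let ?C = "\<Prod>v\<in>V'. card (traces A (S v))"
  have half: "(card B)\<^sup>2 \<le> card (traces B (S u)) * card (traces B (S w)) * ?C"
    if "B \<subseteq> Pow E" and mono: "\<And>v. v \<in> V' \<Longrightarrow> card (traces B (S v)) \<le> card (traces A (S v))"
    for B
  proof -
    have "(card B)\<^sup>2 \<le> (\<Prod>v\<in>V. card (traces B (S v)))"
      using insert.IH[OF that(1)] insert.prems(2) by simp
    also have "\<dots> = card (traces B (S u)) * card (traces B (S w)) *
        (\<Prod>v\<in>V'. card (traces B (S v)))"
      using V by (simp add: mult.assoc)
    also have "\<dots> \<le> card (traces B (S u)) * card (traces B (S w)) * ?C"
      using mono by (intro mult_left_mono prod_mono) auto
    finally show ?thesis .
  qed
  have h0: "(card A0)\<^sup>2 \<le> card (traces A0 (S u)) * card (traces A0 (S w)) * ?C"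
    using half[OF sub0] mono0 by blast
  have h1: "(card A1)\<^sup>2 \<le> card (traces A1 (S u)) * card (traces A1 (S w)) * ?C"
    using half[OF sub1] mono1 e_V' by blast
  have "(real (card A0) + real (card A1))\<^sup>2 \<le>
      (real (card (traces A0 (S u))) + real (card (traces A1 (S u)))) *
      (real (card (traces A0 (S w))) + real (card (traces A1 (S w)))) * real ?C"
    using h0[folded of_nat_le_iff[where 'a = real]] h1[folded of_nat_le_iff[where 'a = real]]
    by (intro cauchy_schwarz_sum_of_two)
       (simp_all only: of_nat_mult of_nat_power of_nat_0_le_iff)
  then have "(card A)\<^sup>2 \<le> card (traces A (S u)) * card (traces A (S w)) * ?C"
    using add[of u] add[of w] uw cardA
    by (metis (no_types, lifting) insertCI mem_Collect_eq of_nat_add of_nat_le_iff of_nat_mult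
        of_nat_power)
  then show ?case
    using V by (simp add: mult.assoc)
qed

lemma card_no_complementary_pair:
  assumes "finite S" "P \<subseteq> Pow S" "\<And>X. X \<in> P \<Longrightarrow> S - X \<notin> P"
  shows "2 * card P \<le> 2 ^ card S"
proof -
  have fin: "finite P"
    using assms(1,2) by (simp add: finite_subset)
  have "inj_on (\<lambda>X. S - X) P"
    using assms(2) by (intro inj_onI) blast
  then have "2 * card P = card P + card ((\<lambda>X. S - X) ` P)"
    by (simp add: card_image)
  also have "\<dots> = card (P \<union> (\<lambda>X. S - X) ` P)"
    using fin assms(3) by (intro card_Un_disjoint[symmetric]) auto
  also have "\<dots> \<le> card (Pow S)"
    using assms(1,2) by (intro card_mono) auto
  finally show ?thesis
    using assms(1) by (simp add: card_Pow)
qed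

section \<open>Edges, stars and admissible families\<close>

definition all_edges :: "nat \<Rightarrow> nat set set" where
  "all_edges n = {e. e \<subseteq> {1..n} \<and> card e = 2}"

definition star :: "nat \<Rightarrow> nat \<Rightarrow> nat set set" where
  "star n v = (\<lambda>u. {v, u}) ` ({1..n} - {v})"

lemma finite_all_edges [simp]: "finite (all_edges n)"
  unfolding all_edges_def by (rule finite_subset[of _ "Pow {1..n}"]) auto

lemma card_all_edges: "card (all_edges n) = n choose 2"
  unfolding all_edges_def using n_subsets[of "{1..n}" 2] by simp

lemma card_star: "v \<in> {1..n} \<Longrightarrow> card (star n v) = n - 1"
  unfolding star_def by (subst card_image) (auto simp: inj_on_def doubleton_eq_iff)

lemma all_edges_memE:
  assumes "e \<in> all_edges n"
  obtains x y where "e = {x, y}" "x \<noteq> y" "x \<in> {1..n}" "y \<in> {1..n}"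
  using assms unfolding all_edges_def card_2_iff by auto

lemma edge_in_two_stars:
  assumes "e \<in> all_edges n"
  shows "card {v \<in> {1..n}. e \<in> star n v} = 2"
proof -
  obtain x y where xy: "e = {x, y}" "x \<noteq> y" "x \<in> {1..n}" "y \<in> {1..n}"
    using assms by (rule all_edges_memE)
  have "{v \<in> {1..n}. e \<in> star n v} = {x, y}"
    using xy by (auto simp: star_def doubleton_eq_iff)
  then show ?thesis
    using xy by simp
qed

lemma graphs_on_eq: "graphs_on n = (\<lambda>F. ({1..n}, F)) ` Pow (all_edges n)"
proof (rule set_eqI)
  fix G :: graph
  obtain X F where G: "G = (X, F)"
    by (cases G)
  show "G \<in> graphs_on n \<longleftrightarrow> G \<in> (\<lambda>F. ({1..n}, F)) ` Pow (all_edges n)"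
    unfolding G by (simp add: graphs_on_def simple_graph_def all_edges_def image_iff) blast
qed

lemma spanning_star_iff:
  assumes "G \<in> graphs_on n"
  shows "G \<in> spanning_star_graphs \<longleftrightarrow> (\<exists>v\<in>{1..n}. star n v \<subseteq> edges G)"
proof -
  have "simple_graph G" and "verts G = {1..n}"
    using assms by (simp_all add: graphs_on_def)
  then show ?thesis
    by (simp only: spanning_star_graphs_def star_def mem_Collect_eq image_subset_iff simp_thms)
qed

section \<open>The upper bound\<close>

lemma card_star_traces:
  assumes A: "diff_avoiding spanning_star_graphs n A" and v: "v \<in> {1..n}" and "n \<noteq> 1"
  shows "card (traces (edges ` A) (star n v)) \<le> 2 ^ (n - 2)"
proof -
  let ?P = "traces (edges ` A) (star n v)"
  have n: "n \<ge> 2"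
    using v \<open>n \<noteq> 1\<close> by auto
  have ne: "star n v \<noteq> {}"
    using card_star[OF v] n by auto
  have "star n v - X \<notin> ?P" if "X \<in> ?P" for X
  proof
    assume "star n v - X \<in> ?P"
    with that obtain G G' where G: "G \<in> A" "G' \<in> A"
      and compl: "edges G' \<inter> star n v = star n v - edges G \<inter> star n v"
      by auto
    \<comment> \<open>A graph is not complementary to itself on a nonempty star.\<close>
    have "G \<noteq> G'"
      using compl ne by blast
    moreover have "graph_xor G G' \<in> spanning_star_graphs"
    proof -
      have "graph_xor G G' \<in> graphs_on n"
        using A G by (auto simp: diff_avoiding_def intro: graph_xor_in_graphs_on)
      moreover have "star n v \<subseteq> edges (graph_xor G G')"
        using compl by (auto simp: graph_xor_def)
      ultimately show ?thesis
        using v by (auto simp: spanning_star_iff)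
    qed
    ultimately show False
      using A G by (auto simp: diff_avoiding_def)
  qed
  then have "2 * card ?P \<le> 2 ^ card (star n v)"
    by (intro card_no_complementary_pair) (auto simp: star_def)
  also have "card (star n v) = Suc (n - 2)"
    using card_star[OF v] n by simp
  finally show ?thesis
    by simp
qed

lemma D_spanning_star_upper:
  assumes "n \<noteq> 1"
  shows "(D spanning_star_graphs n)\<^sup>2 \<le> 2 ^ (n * (n - 2))"
proof -
  obtain A where A: "diff_avoiding spanning_star_graphs n A"
    and card_A: "card A = D spanning_star_graphs n"
    using D_attained by blast
  have sub: "A \<subseteq> graphs_on n"
    using A by (simp add: diff_avoiding_def)
  have edges_sub: "edges ` A \<subseteq> Pow (all_edges n)"
    using sub unfolding graphs_on_eq by fastforce
  have "inj_on edges A"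
    using sub by (auto simp: inj_on_def graphs_on_eq)
  then have "(card A)\<^sup>2 = (card (edges ` A))\<^sup>2"
    by (simp add: card_image)
  also have "\<dots> \<le> (\<Prod>v\<in>{1..n}. card (traces (edges ` A) (star n v)))"
    using edges_sub edge_in_two_stars
    by (intro shearer_double_cover[where E = "all_edges n"]) simp_all
  also have "\<dots> \<le> (\<Prod>v\<in>{1..n}. 2 ^ (n - 2))"
    using card_star_traces[OF A] assms by (intro prod_mono) auto
  also have "\<dots> = 2 ^ (n * (n - 2))"
    by (simp add: power_mult[symmetric] mult.commute)
  finally show ?thesis
    by (simp add: card_A)
qed

section \<open>The lower bound\<close>

text \<open>
  If \<open>M\<close> meets every star, then no graph outside \<open>M\<close> contains a spanning star, and
  the graphs outside \<open>M\<close> form a subspace of codimension \<open>card M\<close>.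
\<close>

lemma D_spanning_star_ge_of_edge_cover:
  assumes M: "M \<subseteq> all_edges n"
    and cover: "\<And>v. v \<in> {1..n} \<Longrightarrow> star n v \<inter> M \<noteq> {}"
  shows "2 ^ ((n choose 2) - card M) \<le> D spanning_star_graphs n"
proof -
  let ?A = "(\<lambda>F. ({1..n}, F)) ` Pow (all_edges n - M)"
  have sub: "?A \<subseteq> graphs_on n"
    unfolding graphs_on_eq by auto
  have "graph_xor G G' \<notin> spanning_star_graphs" if "G \<in> ?A" "G' \<in> ?A" for G G'
  proof -
    have "graph_xor G G' \<in> graphs_on n"
      using that sub by (blast intro: graph_xor_in_graphs_on)
    moreover have "edges (graph_xor G G') \<inter> M = {}"
      using that by (auto simp: graph_xor_def)
    moreover have "\<not> star n v \<subseteq> F" if "v \<in> {1..n}" "F \<inter> M = {}" for v F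
      using cover[OF that(1)] that(2) by blast
    ultimately show ?thesis
      by (metis spanning_star_iff)
  qed
  with sub have "diff_avoiding spanning_star_graphs n ?A"
    unfolding diff_avoiding_def by blast
  then have "card ?A \<le> D spanning_star_graphs n"
    by (rule D_upper)
  also have "card ?A = card (Pow (all_edges n - M))"
    by (intro card_image) (auto simp: inj_on_def)
  also have "\<dots> = 2 ^ ((n choose 2) - card M)"
    using M by (simp add: card_Pow card_Diff_subset finite_subset[OF M] card_all_edges)
  finally show ?thesis .
qed

lemma ex_small_edge_cover:
  assumes "n \<noteq> 1"
  shows "\<exists>M \<subseteq> all_edges n. card M \<le> (n + 1) div 2 \<and> (\<forall>v\<in>{1..n}. star n v \<inter> M \<noteq> {})"
proof -
  define M0 where "M0 = (\<lambda>i. {2 * i + 1, 2 * i + 2}) ` {..<n div 2}"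
  \<comment> \<open>\<open>M0\<close> is a perfect matching of \<open>{1..n}\<close> for even \<open>n\<close>, and of \<open>{1..n - 1}\<close> for odd \<open>n\<close>.\<close>
  define M where "M = M0 \<union> (if odd n then {{n - 1, n}} else {})"
  have "card M0 \<le> n div 2"
    unfolding M0_def using card_image_le[of "{..<n div 2}"] by simp
  then have "card M \<le> (n + 1) div 2"
    unfolding M_def using card_Un_le[of M0 "{{n - 1, n}}"] by (auto elim!: oddE)
  moreover have "M \<subseteq> all_edges n"
    using assms by (auto simp: M_def M0_def all_edges_def elim!: oddE)
  moreover have "star n v \<inter> M \<noteq> {}" if v: "v \<in> {1..n}" for v
  proof -
    have "\<exists>u\<in>{1..n} - {v}. {v, u} \<in> M"
    proof (cases "odd n \<and> v = n")
      case True
      then have "n - 1 \<in> {1..n} - {v}" "{v, n - 1} \<in> M"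
        using assms v by (auto simp: M_def insert_commute elim!: oddE)
      then show ?thesis by blast
    next
      case False
      define i where "i = (v - 1) div 2"
      have "i < n div 2" and i: "v = 2 * i + 1 \<or> v = 2 * i + 2"
        using v False unfolding i_def by (auto; presburger)+
      then have mem: "{2 * i + 1, 2 * i + 2} \<in> M"
        by (auto simp: M_def M0_def)
      have le: "2 * i + 2 \<le> n"
        using \<open>i < n div 2\<close> by linarith
      show ?thesis
        using i
      proof
        assume "v = 2 * i + 1"
        then show ?thesis
          using mem le by (intro bexI[of _ "2 * i + 2"]) auto
      next
        assume "v = 2 * i + 2"
        then show ?thesis
          using mem le by (intro bexI[of _ "2 * i + 1"]) (auto simp: insert_commute)
      qed
    qed
    then show ?thesis
      by (auto simp: star_def)
  qed
  ultimately show ?thesis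
    by blast
qed

lemma D_spanning_star_lower:
  assumes "n \<noteq> 1"
  shows "2 ^ ((n choose 2) - (n + 1) div 2) \<le> D spanning_star_graphs n"
proof -
  obtain M where M: "M \<subseteq> all_edges n" "card M \<le> (n + 1) div 2"
      "\<And>v. v \<in> {1..n} \<Longrightarrow> star n v \<inter> M \<noteq> {}"
    using ex_small_edge_cover[OF assms] by blast
  have "(2 :: nat) ^ ((n choose 2) - (n + 1) div 2) \<le> 2 ^ ((n choose 2) - card M)"
    using M(2) by (intro power_increasing) auto
  also have "\<dots> \<le> D spanning_star_graphs n"
    using M by (intro D_spanning_star_ge_of_edge_cover)
  finally show ?thesis .
qed

section \<open>The value for even order and the bounds for odd order\<close>

lemma D_spanning_star_le_powr:
  assumes "n \<noteq> 1"
  shows "real (D spanning_star_graphs n) \<le> 2 powr (real (n choose 2) - real n / 2)"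
proof (rule power2_le_imp_le)
  have exponent: "real (n * (n - 2)) = 2 * (real (n choose 2) - real n / 2)"
  proof (cases "n = 0")
    case False
    then have pred: "real (n - 1) = real n - 1"
      by (simp add: of_nat_diff)
    have "2 * (n choose 2) = n * (n - 1)"
      unfolding choose_two by (rule dvd_mult_div_cancel) auto
    then have "2 * real (n choose 2) = real n * (real n - 1)"
      using pred by (metis of_nat_mult of_nat_numeral)
    moreover have "real (n - 2) = real n - 2"
      using False assms by (simp add: of_nat_diff)
    ultimately show ?thesis
      by (simp only: of_nat_mult) (simp add: algebra_simps)
  qed (simp add: binomial_eq_0)
  have "(real (D spanning_star_graphs n))\<^sup>2 \<le> 2 ^ (n * (n - 2))"
    using D_spanning_star_upper[OF assms, folded of_nat_le_iff[where 'a = real]] by simp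
  also have "\<dots> = 2 powr real (n * (n - 2))"
    by (simp only: powr_realpow zero_less_numeral)
  also have "\<dots> = (2 powr (real (n choose 2) - real n / 2))\<^sup>2"
    unfolding exponent by (simp add: power2_eq_square powr_add[symmetric])
  finally show "(real (D spanning_star_graphs n))\<^sup>2 \<le>
      (2 powr (real (n choose 2) - real n / 2))\<^sup>2" .
qed simp

lemma D_spanning_star_ge_powr:
  assumes "n \<noteq> 1"
  shows "2 powr (real (n choose 2) - real ((n + 1) div 2)) \<le> real (D spanning_star_graphs n)"
proof -
  have "2 powr (real (n choose 2) - real ((n + 1) div 2)) \<le>
      2 powr real ((n choose 2) - (n + 1) div 2)"
    by (intro powr_mono) auto
  also have "\<dots> = real (2 ^ ((n choose 2) - (n + 1) div 2))"
    by (simp add: powr_realpow)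
  also have "\<dots> \<le> real (D spanning_star_graphs n)"
    using D_spanning_star_lower[OF assms] by (simp only: of_nat_le_iff)
  finally show ?thesis .
qed

theorem theorem8:
  fixes n :: nat
  shows "(even n \<longrightarrow>
           real (D spanning_star_graphs n) = 2 powr (real (n choose 2) - real n / 2)) \<and>
         (odd n \<and> n > 1 \<longrightarrow>
           2 powr (real (n choose 2) - (real n + 1) / 2) \<le> real (D spanning_star_graphs n) \<and>
           real (D spanning_star_graphs n) \<le> 2 powr (real (n choose 2) - real n / 2))"
proof (intro conjI impI)
  assume "even n"
  then have "real ((n + 1) div 2) = real n / 2" and "n \<noteq> 1"
    by (auto elim!: evenE)
  then show "real (D spanning_star_graphs n) = 2 powr (real (n choose 2) - real n / 2)"
    using D_spanning_star_le_powr[of n] D_spanning_star_ge_powr[of n] by (metis order_antisym)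
next
  assume n: "odd n \<and> n > 1"
  then have "real ((n + 1) div 2) = (real n + 1) / 2"
    by (auto elim!: oddE)
  then show "2 powr (real (n choose 2) - (real n + 1) / 2) \<le> real (D spanning_star_graphs n)"
    using D_spanning_star_ge_powr[of n] n by (metis less_irrefl)
  show "real (D spanning_star_graphs n) \<le> 2 powr (real (n choose 2) - real n / 2)"
    using D_spanning_star_le_powr[of n] n by simp
qed

end
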